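(* Let $G$ be a finite simple graph with $n$ vertices and let $a=(1,\ldots,1)\in\mathbb{N}^n$. Then $a$ is a reducible $\alpha_0(G)$-cover of $\Upsilon(G)$ if and only if there are induced subgraphs $H_1$ and $H_2$ of $G$, with nonempty vertex sets, such that (i) $V(G)$ is the disjoint union of $V(H_1)$ and $V(H_2)$, and (ii) $\alpha_0(G)=\alpha_0(H_1)+\alpha_0(H_2)$.
   Context: Let $V(G)=\{x_1,\ldots,x_n\}$. $\alpha_0(G)$ is the minimum number of vertices in a vertex cover of $G$ (a set of vertices meeting every edge); if $H$ is a discrete graph (no edges), $\alpha_0(H)=0$. $\Upsilon(G)$, the blocker of $G$, is the clutter on $V(G)$ whose edges are the minimal vertex covers of $G$. Let $u_1,\ldots,u_s\in\{0,1\}^n$ be the incidence vectors of the minimal vertex covers of $G$. For $b\in\mathbb{N}=\{0,1,2,\ldots\}$, a nonzero vector $a\in\mathbb{N}^n$ is a $b$-cover of $\Upsilon(G)$ if $\langle u_k,a\rangle\geq b$ for $k=1,\ldots,s$. A $b$-cover $a$ of $\Upsilon(G)$ is reducible if there exist an $i$-cover $c$ and a $j$-cover $d$ of $\Upsilon(G)$ ($c,d$ nonzero vectors in $\mathbb{N}^n$, $i,j\in\mathbb{N}$) such that $a=c+d$ and $b=i+j$. *)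

theory Defs
  imports "Graph_Theory.Digraph_Component" "HOL-Library.Indicator_Function"
begin

(* Finite simple graphs are the library's locale "graph": finite, loop-free, symmetric digraphs
   without parallel arcs. Each undirected edge is a pair of opposite arcs, and a set of vertices
   meets the edge iff it contains the tail or the head of either of these arcs. *)

definition vertex_cover :: "('a, 'b) pre_digraph \<Rightarrow> 'a set \<Rightarrow> bool" where
  "vertex_cover G C \<longleftrightarrow> C \<subseteq> verts G \<and> (\<forall>e \<in> arcs G. tail G e \<in> C \<or> head G e \<in> C)"

definition minimal_vertex_cover :: "('a, 'b) pre_digraph \<Rightarrow> 'a set \<Rightarrow> bool" where
  "minimal_vertex_cover G C \<longleftrightarrow> vertex_cover G C \<and> (\<forall>D. D \<subset> C \<longrightarrow> \<not> vertex_cover G D)"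

definition alpha0 :: "('a, 'b) pre_digraph \<Rightarrow> nat" where
  "alpha0 G = (LEAST k. \<exists>C. vertex_cover G C \<and> card C = k)"

lemma alpha0_discrete: "arcs G = {} \<Longrightarrow> alpha0 G = 0"
  unfolding alpha0_def by (rule Least_eq_0, rule exI[of _ "{}"]) (simp add: vertex_cover_def)

record 'a clutter =
  cverts :: "'a set"
  cedges :: "'a set set"

definition is_clutter :: "'a clutter \<Rightarrow> bool" where
  "is_clutter K \<longleftrightarrow> finite (cverts K) \<and> (\<forall>E \<in> cedges K. E \<subseteq> cverts K) \<and>
     (\<forall>E \<in> cedges K. \<forall>F \<in> cedges K. E \<subseteq> F \<longrightarrow> E = F)"

definition blocker :: "('a, 'b) pre_digraph \<Rightarrow> 'a clutter" where
  "blocker G = \<lparr> cverts = verts G, cedges = {C. minimal_vertex_cover G C} \<rparr>"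

lemma is_clutter_blocker:
  assumes "finite (verts G)"
  shows "is_clutter (blocker G)"
proof -
  have "E \<subseteq> verts G" if "minimal_vertex_cover G E" for E
    using that by (simp only: minimal_vertex_cover_def vertex_cover_def)
  moreover have "E = F"
    if "minimal_vertex_cover G E" "minimal_vertex_cover G F" "E \<subseteq> F" for E F
    using that unfolding minimal_vertex_cover_def psubset_eq by metis
  ultimately show ?thesis
    using assms by (simp add: is_clutter_def blocker_def)
qed

(* Vectors with coordinates indexed by a vertex set V: functions vanishing off V, so that
   two of them are equal as functions iff all coordinates in V agree. *)

definition nat_vectors :: "'a set \<Rightarrow> ('a \<Rightarrow> nat) set" where
  "nat_vectors V = {a. \<forall>v. v \<notin> V \<longrightarrow> a v = 0}"

definition dot :: "'a set \<Rightarrow> ('a \<Rightarrow> nat) \<Rightarrow> ('a \<Rightarrow> nat) \<Rightarrow> nat" where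
  "dot V u a = (\<Sum>v\<in>V. u v * a v)"

definition is_cover :: "'a clutter \<Rightarrow> nat \<Rightarrow> ('a \<Rightarrow> nat) \<Rightarrow> bool" where
  "is_cover K b a \<longleftrightarrow> a \<in> nat_vectors (cverts K) \<and> a \<noteq> (\<lambda>v. 0) \<and>
     (\<forall>E \<in> cedges K. dot (cverts K) (indicator E) a \<ge> b)"

definition is_reducible_cover :: "'a clutter \<Rightarrow> nat \<Rightarrow> ('a \<Rightarrow> nat) \<Rightarrow> bool" where
  "is_reducible_cover K b a \<longleftrightarrow> is_cover K b a \<and>
     (\<exists>i j c d. is_cover K i c \<and> is_cover K j d \<and> a = (\<lambda>v. c v + d v) \<and> b = i + j)"

end

theory Submission
  imports Defs
begin

text \<open>The splittings of the all-ones vector into two nonzero vectors correspond to the partitions of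
  the vertex set into two nonempty parts. The indicator of \<open>A\<close> is an \<open>i\<close>-cover iff \<open>i\<close> is at most
  the covering number of the subgraph induced on \<open>A\<close>: a minimal cover of \<open>G\<close> restricts to a cover
  on \<open>A\<close>, and conversely a cover on \<open>A\<close> together with all vertices outside \<open>A\<close> covers \<open>G\<close>, hence
  contains a minimal cover. Finally, the covering number is superadditive over the two parts.\<close>

lemma alpha0_le_card: "vertex_cover G C \<Longrightarrow> alpha0 G \<le> card C"
  unfolding alpha0_def by (rule Least_le) blast

lemma (in wf_digraph) vertex_cover_verts: "vertex_cover G (verts G)"
  by (simp add: vertex_cover_def)

text \<open>The \<open>LEAST\<close> in \<open>alpha0\<close> is attained because the whole vertex
  set is a cover.\<close>

lemma (in wf_digraph) obtain_minimum_vertex_cover: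
  obtains C where "vertex_cover G C" "card C = alpha0 G"
proof -
  have "\<exists>C. vertex_cover G C \<and> card C = alpha0 G"
    unfolding alpha0_def by (rule LeastI_ex) (use vertex_cover_verts in blast)
  then show thesis using that by blast
qed

lemma (in fin_digraph) obtain_minimal_vertex_cover_subset:
  assumes "vertex_cover G C"
  obtains D where "minimal_vertex_cover G D" "D \<subseteq> C"
proof -
  have "finite {D. vertex_cover G D}"
    by (rule finite_subset[of _ "Pow (verts G)"]) (auto simp: vertex_cover_def)
  from finite_has_minimal2[OF this, of C] assms obtain D
    where "vertex_cover G D" "D \<subseteq> C" "\<And>E. vertex_cover G E \<Longrightarrow> E \<subseteq> D \<Longrightarrow> D = E"
    by auto
  then have "minimal_vertex_cover G D" "D \<subseteq> C"
    unfolding minimal_vertex_cover_def by blast+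
  then show thesis by (rule that)
qed

text \<open>The right side quantifies over the arcs of \<open>G\<close> only, so covers of
  \<open>H\<close> and of \<open>G\<close> can be compared arc by arc.\<close>

lemma vertex_cover_induced_iff:
  assumes "induced_subgraph H G"
  shows "vertex_cover H C \<longleftrightarrow> C \<subseteq> verts H \<and>
    (\<forall>e\<in>arcs G. tail G e \<in> verts H \<longrightarrow> head G e \<in> verts H \<longrightarrow> tail G e \<in> C \<or> head G e \<in> C)"
proof -
  have "arcs H = {e \<in> arcs G. tail G e \<in> verts H \<and> head G e \<in> verts H}"
    "tail H = tail G" "head H = head G"
    using assms by (auto simp: induced_subgraph_def subgraph_def compatible_def)
  then show ?thesis by (auto simp: vertex_cover_def)
qed

lemma vertex_cover_Int_induced:
  assumes "induced_subgraph H G" "vertex_cover G C"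
  shows "vertex_cover H (C \<inter> verts H)"
  using assms(2) by (auto simp: vertex_cover_induced_iff[OF assms(1)] vertex_cover_def[of G])

text \<open>An arc of \<open>G\<close> with both ends in \<open>H\<close> is met by
  \<open>C\<close>; any other arc has an end outside \<open>verts H\<close>, which lies in
  \<open>verts G\<close> by well-formedness.\<close>

lemma (in wf_digraph) vertex_cover_Un_compl:
  assumes "induced_subgraph H G" "vertex_cover H C"
  shows "vertex_cover G (C \<union> (verts G - verts H))"
proof -
  have "verts H \<subseteq> verts G"
    using assms(1) by (auto simp: induced_subgraph_def subgraph_def)
  then show ?thesis
    using assms(2) by (auto simp: vertex_cover_induced_iff[OF assms(1)] vertex_cover_def[of G])
qed

text \<open>In other words, \<open>alpha0 H\<close> is the minimum of
  \<open>card (E \<inter> verts H)\<close> over the minimal covers \<open>E\<close> of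
  \<open>G\<close>. This translates between the blocker and induced subgraphs.\<close>

lemma (in fin_digraph) le_alpha0_induced_iff:
  assumes H: "induced_subgraph H G"
  shows "i \<le> alpha0 H \<longleftrightarrow> (\<forall>E. minimal_vertex_cover G E \<longrightarrow> i \<le> card (E \<inter> verts H))"
proof (intro iffI allI impI)
  fix E assume "i \<le> alpha0 H" "minimal_vertex_cover G E"
  then show "i \<le> card (E \<inter> verts H)"
    using alpha0_le_card[OF vertex_cover_Int_induced[OF H]]
    by (meson minimal_vertex_cover_def order_trans)
next
  assume *: "\<forall>E. minimal_vertex_cover G E \<longrightarrow> i \<le> card (E \<inter> verts H)"
  have "subgraph H G" using H by (simp add: induced_subgraph_def)
  then interpret H: wf_digraph H by (simp add: subgraph_def)
  obtain C where C: "vertex_cover H C" "card C = alpha0 H"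
    by (rule H.obtain_minimum_vertex_cover)
  obtain E where E: "minimal_vertex_cover G E" "E \<subseteq> C \<union> (verts G - verts H)"
    by (rule obtain_minimal_vertex_cover_subset[OF vertex_cover_Un_compl[OF H C(1)]])
  have "C \<subseteq> verts G"
    using C(1) \<open>subgraph H G\<close> by (auto simp: vertex_cover_def subgraph_def)
  \<comment> \<open>Intersecting with \<open>verts H\<close> discards the added complement, so what
    remains of \<open>E\<close> lies in the minimum cover \<open>C\<close>.\<close>
  then have "card (E \<inter> verts H) \<le> card C"
    using E(2) by (intro card_mono) (auto intro: finite_subset)
  then show "i \<le> alpha0 H" using * E(1) C(2) by force
qed

text \<open>The pairing of two indicators counts the intersection of their sets. Nonemptiness of
  \<open>verts H\<close> is the requirement that a cover be a nonzero vector.\<close>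

lemma (in fin_digraph) is_cover_indicator_induced_iff:
  assumes H: "induced_subgraph H G"
  shows "is_cover (blocker G) i (indicator (verts H)) \<longleftrightarrow> verts H \<noteq> {} \<and> i \<le> alpha0 H"
proof -
  have sub: "verts H \<subseteq> verts G"
    using H by (auto simp: induced_subgraph_def subgraph_def)
  have dot: "dot (verts G) (indicator E) (indicator (verts H)) = card (E \<inter> verts H)" for E
  proof -
    have "dot (verts G) (indicator E) (indicator (verts H))
        = (\<Sum>v\<in>verts G. indicator (E \<inter> verts H) v)"
      by (simp add: dot_def indicator_inter_arith)
    also have "\<dots> = card (E \<inter> verts H)"
      using sub by (simp add: sum_indicator_eq_card Int_absorb1 le_infI2)
    finally show ?thesis .
  qed
  have "indicator (verts H) \<noteq> (\<lambda>v. 0::nat) \<longleftrightarrow> verts H \<noteq> {}"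
    by (auto simp: fun_eq_iff indicator_def)
  moreover have "indicator (verts H) \<in> nat_vectors (verts G)"
    using sub by (auto simp: nat_vectors_def indicator_def)
  ultimately show ?thesis
    by (simp add: is_cover_def blocker_def dot le_alpha0_induced_iff[OF H])
qed

lemma is_cover_add:
  assumes "is_cover K i c" "is_cover K j d"
  shows "is_cover K (i + j) (\<lambda>v. c v + d v)"
  using assms
  by (auto simp: is_cover_def nat_vectors_def dot_def fun_eq_iff distrib_left sum.distrib
      intro!: add_mono)

text \<open>A minimum cover of \<open>G\<close> cuts out disjoint covers of \<open>H1\<close> and
  \<open>H2\<close>.\<close>

lemma (in fin_digraph) alpha0_superadditive:
  assumes "induced_subgraph H1 G" "induced_subgraph H2 G" "verts H1 \<inter> verts H2 = {}"
  shows "alpha0 H1 + alpha0 H2 \<le> alpha0 G"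
proof -
  obtain C where C: "vertex_cover G C" "card C = alpha0 G"
    by (rule obtain_minimum_vertex_cover)
  have "finite C" using C(1) by (auto simp: vertex_cover_def intro: finite_subset)
  have "alpha0 H1 + alpha0 H2 \<le> card (C \<inter> verts H1) + card (C \<inter> verts H2)"
    using assms C(1) by (intro add_mono alpha0_le_card vertex_cover_Int_induced)
  also have "\<dots> = card (C \<inter> verts H1 \<union> C \<inter> verts H2)"
    using assms(3) \<open>finite C\<close> by (intro card_Un_disjoint[symmetric]) auto
  also have "\<dots> \<le> card C" using \<open>finite C\<close> by (intro card_mono) auto
  finally show ?thesis using C(2) by simp
qed

text \<open>Two naturals with sum at most 1 are each 0 or 1 and not both 1, so the supports of
  \<open>c\<close> and \<open>d\<close> serve as \<open>A\<close> and \<open>B\<close>.\<close>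

lemma indicator_eq_addE:
  fixes c d :: "'a \<Rightarrow> nat"
  assumes "indicator V = (\<lambda>v. c v + d v)"
  obtains A B where "c = indicator A" "d = indicator B" "V = A \<union> B" "A \<inter> B = {}"
proof -
  have *: "c v + d v = (if v \<in> V then 1 else 0)" for v
    using fun_cong[OF assms, of v] by (cases "v \<in> V") simp_all
  have le: "c v + d v \<le> 1" for v
    by (simp add: *)
  have "c v \<le> 1" "d v \<le> 1" for v
    using le[of v] by simp_all
  then have c: "c = indicator {v. c v \<noteq> 0}" and d: "d = indicator {v. d v \<noteq> 0}"
    by (simp_all add: fun_eq_iff indicator_def le_antisym Suc_leI)
  show thesis
  proof (rule that[OF c d])
    show "V = {v. c v \<noteq> 0} \<union> {v. d v \<noteq> 0}"
      using * by (force split: if_splits)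
    show "{v. c v \<noteq> 0} \<inter> {v. d v \<noteq> 0} = {}"
    proof (intro equals0I)
      fix v assume "v \<in> {v. c v \<noteq> 0} \<inter> {v. d v \<noteq> 0}"
      then show False using le[of v] by simp
    qed
  qed
qed

theorem theorem5p2p7:
  fixes G :: "('a, 'b) pre_digraph"
  assumes "graph G"
  shows "is_reducible_cover (blocker G) (alpha0 G) (indicator (verts G)) \<longleftrightarrow>
    (\<exists>H1 H2. induced_subgraph H1 G \<and> induced_subgraph H2 G \<and>
       verts H1 \<noteq> {} \<and> verts H2 \<noteq> {} \<and>
       verts G = verts H1 \<union> verts H2 \<and> verts H1 \<inter> verts H2 = {} \<and>
       alpha0 G = alpha0 H1 + alpha0 H2)"
    (is "?L \<longleftrightarrow> ?R")
proof
  interpret graph G by fact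
  assume ?L
  then obtain i j c d where ij: "is_cover (blocker G) i c" "is_cover (blocker G) j d"
      "alpha0 G = i + j" and "indicator (verts G) = (\<lambda>v. c v + d v)"
    unfolding is_reducible_cover_def by blast
  then obtain A B where AB: "c = indicator A" "d = indicator B" "verts G = A \<union> B" "A \<inter> B = {}"
    by (elim indicator_eq_addE)
  let ?H1 = "G \<restriction> A" and ?H2 = "G \<restriction> B"
  have H: "induced_subgraph ?H1 G" "induced_subgraph ?H2 G"
    using AB(3) by (auto intro!: induced_induce)
  have *: "A \<noteq> {}" "i \<le> alpha0 ?H1" "B \<noteq> {}" "j \<le> alpha0 ?H2"
    using ij(1,2) is_cover_indicator_induced_iff[OF H(1)] is_cover_indicator_induced_iff[OF H(2)]
    by (simp_all add: AB(1,2))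
  have "alpha0 ?H1 + alpha0 ?H2 \<le> alpha0 G"
    using alpha0_superadditive[OF H] AB(4) by simp
  \<comment> \<open>The reverse inequality is \<open>alpha0 G = i + j\<close> together with the
    bounds on \<open>i\<close> and \<open>j\<close>.\<close>
  then have "alpha0 G = alpha0 ?H1 + alpha0 ?H2" using * ij(3) by linarith
  then show ?R using H * AB(3,4)
    by (intro exI[of _ ?H1] exI[of _ ?H2]) simp
next
  interpret graph G by fact
  assume ?R
  then obtain H1 H2 where H: "induced_subgraph H1 G" "induced_subgraph H2 G"
      "verts H1 \<noteq> {}" "verts H2 \<noteq> {}" "verts G = verts H1 \<union> verts H2"
      "verts H1 \<inter> verts H2 = {}" "alpha0 G = alpha0 H1 + alpha0 H2" by blast
  \<comment> \<open>Each indicator is taken at the largest level it admits.\<close>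
  have *: "is_cover (blocker G) (alpha0 H1) (indicator (verts H1))"
      "is_cover (blocker G) (alpha0 H2) (indicator (verts H2))"
    using H by (simp_all add: is_cover_indicator_induced_iff)
  have "indicator (verts G) = (\<lambda>v. indicator (verts H1) v + indicator (verts H2) v :: nat)"
    using H(5,6) by (auto simp: fun_eq_iff indicator_def)
  \<comment> \<open>Reducibility also asks that the all-ones vector itself be an
    \<open>alpha0 G\<close>-cover; \<open>is_cover_add\<close> supplies this.\<close>
  then show ?L
    using is_cover_add[OF *] * H(7) unfolding is_reducible_cover_def by metis
qed

end
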